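(* Let $n\ge2$, let $G=(V,E)$ be an undirected graph (self-loops allowed) with $V=\{1,\dots,n\}$, and let $1\le r\le n$. If $\mathcal L$ and $\mathcal L^c$ are connected (i.e. some edge of $E$ joins a vertex of $\mathcal L$ to a vertex of $\mathcal L^c$), then $\mathcal P(\mathcal S^n_{r+})$ is not closed.
   Context: $\mathcal S^n$ is the space of real symmetric $n\times n$ matrices and $\mathcal S^n_{r+}\subseteq\mathcal S^n$ is the set of positive semidefinite matrices of rank at most $r$. The graph $G=(V,E)$ has index set $E\subseteq\{ij: 1\le i\le j\le n\}$, where $ii\in E$ means that vertex $i$ has a self-loop. $\mathcal P:\mathcal S^n\to\mathbb R^E$ is the coordinate projection $\mathcal P(X)=(X_{ij})_{ij\in E}$, and $\mathcal P(\mathcal S^n_{r+})$ is the image of $\mathcal S^n_{r+}$; closedness is in the Euclidean space $\mathbb R^E$. $\mathcal L=\{i: ii\in E\}$ and $\mathcal L^c=V\setminus\mathcal L$. *)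

theory Defs
  imports "HOL-Analysis.Analysis"
begin

text \<open>
  The vertex set \<open>{1, \<dots>, n}\<close> is an arbitrary finite linearly ordered type \<open>'n\<close> with
  \<open>n = CARD('n)\<close>.
\<close>

definition symmetric_matrices :: "(real^'n^'n) set" where
  "symmetric_matrices = {X. transpose X = X}"

definition pos_semidef :: "real^'n^'n \<Rightarrow> bool" where
  "pos_semidef X \<longleftrightarrow> (\<forall>v. 0 \<le> v \<bullet> (X *v v))"

definition psd_rank_le :: "nat \<Rightarrow> (real^'n^'n) set" where
  "psd_rank_le r = {X \<in> symmetric_matrices. pos_semidef X \<and> rank X \<le> r}"

text \<open>
  An undirected graph with possible self-loops is given by its edge set, in which the edge between
  \<open>i\<close> and \<open>j\<close> is represented once, by the pair whose first component is the smaller one.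
\<close>

definition is_graph :: "('n::linorder \<times> 'n) set \<Rightarrow> bool" where
  "is_graph E \<longleftrightarrow> E \<subseteq> {(i, j). i \<le> j}"

definition looped :: "('n \<times> 'n) set \<Rightarrow> 'n set" where
  "looped E = {i. (i, i) \<in> E}"

definition joined :: "('n \<times> 'n) set \<Rightarrow> 'n set \<Rightarrow> 'n set \<Rightarrow> bool" where
  "joined E A B \<longleftrightarrow> (\<exists>i\<in>A. \<exists>j\<in>B. (i, j) \<in> E \<or> (j, i) \<in> E)"

text \<open>
  The space of real families indexed by \<open>E\<close> consists of the functions that are \<open>undefined\<close>
  outside \<open>E\<close>; this is the underlying set of \<open>powertop_real E\<close>, whose (product) topology is the
  Euclidean one because \<open>E\<close> is finite.
\<close>

definition coord_proj :: "('n \<times> 'n) set \<Rightarrow> real^'n^'n \<Rightarrow> ('n \<times> 'n \<Rightarrow> real)" where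
  "coord_proj E X = (\<lambda>(i, j)\<in>E. X $ i $ j)"

end

theory Submission
  imports Defs
begin

text \<open>
  Let \<open>i\<close> be looped, \<open>j\<close> not looped, and \<open>i\<close>, \<open>j\<close> adjacent. The rank-one matrices \<open>x x\<^sup>T\<close> with
  \<open>x = e\<^sub>i / k + k e\<^sub>j\<close> have only one unbounded entry, at \<open>(j, j)\<close>, which the projection does not
  see. Their projections therefore converge, to a family whose entry at \<open>(i, i)\<close> is \<open>0\<close> and whose
  entry at the edge between \<open>i\<close> and \<open>j\<close> is \<open>1\<close>. No positive semidefinite matrix has such entries.
\<close>

definition outer_square :: "real^'n \<Rightarrow> real^'n^'n" where
  "outer_square x = (\<chi> a b. x $ a * x $ b)"

lemma outer_square_mult_vec: "outer_square x *v v = (x \<bullet> v) *\<^sub>R x"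
  by (simp add: vec_eq_iff outer_square_def matrix_vector_mult_def inner_vec_def
      sum_distrib_left mult_ac)

lemma rank_outer_square_le: "rank (outer_square x) \<le> 1"
proof -
  have "range ((*v) (outer_square x)) \<subseteq> span {x}"
    by (auto simp: outer_square_mult_vec span_base span_scale)
  then have "dim (range ((*v) (outer_square x))) \<le> card {x}"
    by (intro dim_le_card) auto
  then show ?thesis
    by (simp add: rank_dim_range)
qed

lemma outer_square_in_psd_rank_le:
  assumes "1 \<le> r"
  shows "outer_square x \<in> psd_rank_le r"
proof -
  have "transpose (outer_square x) = outer_square x"
    by (simp add: vec_eq_iff transpose_def outer_square_def mult.commute)
  moreover have "pos_semidef (outer_square x)"
    by (simp add: pos_semidef_def outer_square_mult_vec inner_commute)
  ultimately show ?thesis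
    using assms rank_outer_square_le[of x]
    by (simp add: psd_rank_le_def symmetric_matrices_def)
qed

text \<open>Since the \<open>(i, i)\<close> entry vanishes, the quadratic form along e_j + t e_i is
  affine in t with slope 2 X_ij, so a nonzero slope would make it negative somewhere.\<close>

lemma pos_semidef_zero_diagonal:
  fixes X :: "real^'n^'n"
  assumes "transpose X = X" "pos_semidef X" "X $ i $ i = 0"
  shows "X $ i $ j = 0"
proof (rule ccontr)
  assume nz: "X $ i $ j \<noteq> 0"
  have entry: "axis a 1 \<bullet> (X *v axis b 1) = X $ a $ b" for a b
    by (simp add: matrix_vector_mul_component inner_axis' inner_axis)
  have sym: "X $ j $ i = X $ i $ j"
    using assms(1) by (metis transpose_def vec_lambda_beta)
  \<comment> \<open>Solution of 2 t X_ij + X_jj = -1.\<close>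
  define t where "t = - (X $ j $ j + 1) / (2 * X $ i $ j)"
  define v :: "real^'n" where "v = t *\<^sub>R axis i 1 + axis j 1"
  have "v \<bullet> (X *v v) = 2 * t * X $ i $ j + X $ j $ j"
    unfolding v_def
    by (simp add: matrix_vector_mult_scaleR entry sym assms(3) algebra_simps)
  also have "\<dots> = - 1"
    using nz by (simp add: t_def field_simps)
  finally show False
    using assms(2) unfolding pos_semidef_def by (metis not_one_le_zero neg_0_le_iff_le)
qed

theorem corollary1p3:
  fixes E :: "('n::{finite, linorder} \<times> 'n) set" and r :: nat
  assumes "CARD('n) \<ge> 2"
    and "is_graph E"
    and "1 \<le> r" and "r \<le> CARD('n)"
    and "joined E (looped E) (- looped E)"
  shows "\<not> closedin (powertop_real E) (coord_proj E ` psd_rank_le r)"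
proof
  assume closed: "closedin (powertop_real E) (coord_proj E ` psd_rank_le r)"
  obtain i j where ii: "(i, i) \<in> E" and jj: "(j, j) \<notin> E" and ij: "(i, j) \<in> E \<or> (j, i) \<in> E"
    using assms(5) by (auto simp: joined_def looped_def)
  have "i \<noteq> j"
    using ii jj by auto
  define x :: "nat \<Rightarrow> (real, 'n) vec" where
    "x k = (1 / real (Suc k)) *\<^sub>R axis i 1 + real (Suc k) *\<^sub>R axis j 1" for k
  \<comment> \<open>The restriction to \<open>E\<close> makes \<open>Y\<close> a point of the
    product space; both orientations are listed because it is not known which of \<open>i\<close>,
    \<open>j\<close> is smaller.\<close>
  define Y :: "'n \<times> 'n \<Rightarrow> real" where
    "Y = (\<lambda>(a, b)\<in>E. if (a, b) = (i, j) \<or> (a, b) = (j, i) then 1 else 0)"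
  have x: "x k $ a = (if a = i then 1 / real (Suc k) else if a = j then real (Suc k) else 0)" for k a
    using \<open>i \<noteq> j\<close> by (auto simp: x_def axis_def)
  have entries: "(\<lambda>k. x k $ a * x k $ b) \<longlonglongrightarrow> Y (a, b)" if ab: "(a, b) \<in> E" for a b
  proof (cases "(a, b) = (i, i)")
    case True
    have "(\<lambda>k. 1 / real (Suc k) * (1 / real (Suc k))) \<longlonglongrightarrow> 0 * 0"
      by (intro tendsto_mult LIMSEQ_Suc[OF lim_1_over_n])
    then show ?thesis
      using True ab \<open>i \<noteq> j\<close> by (simp add: Y_def x)
  next
    case False
    \<comment> \<open>These entries do not depend on \<open>k\<close>: \<open>jj\<close> excludes
      \<open>(j, j)\<close>, the factors at \<open>i\<close> and \<open>j\<close> are reciprocal,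
      and any other index gives a zero factor.\<close>
    then have "x k $ a * x k $ b = Y (a, b)" for k
      using ab jj \<open>i \<noteq> j\<close> by (auto simp: Y_def x simp del: of_nat_Suc)
    then show ?thesis
      by simp
  qed
  \<comment> \<open>Convergence in the product topology is coordinatewise.\<close>
  have limit: "limitin (powertop_real E) (\<lambda>k. coord_proj E (outer_square (x k))) Y sequentially"
    using entries
    by (auto simp: limitin_componentwise coord_proj_def outer_square_def Y_def)
  have "coord_proj E (outer_square (x k)) \<in> coord_proj E ` psd_rank_le r" for k
    by (rule imageI[OF outer_square_in_psd_rank_le[OF assms(3)]])
  then have "\<forall>\<^sub>F k in sequentially. coord_proj E (outer_square (x k)) \<in> coord_proj E ` psd_rank_le r"
    by (rule always_eventually[OF allI])
  then have "Y \<in> coord_proj E ` psd_rank_le r"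
    by (rule limitin_closedin[OF limit closed _ sequentially_bot])
  then obtain X where X: "X \<in> psd_rank_le r" and Y: "Y = coord_proj E X"
    by auto
  have proj: "X $ a $ b = Y (a, b)" if "(a, b) \<in> E" for a b
    using that by (simp add: Y coord_proj_def)
  have sym: "transpose X = X"
    using X by (simp add: psd_rank_le_def symmetric_matrices_def)
  have "X $ i $ i = 0"
    using proj[OF ii] ii \<open>i \<noteq> j\<close> by (simp add: Y_def)
  moreover have "pos_semidef X"
    using X by (simp add: psd_rank_le_def)
  ultimately have "X $ i $ j = 0"
    using pos_semidef_zero_diagonal[OF sym] by simp
  \<comment> \<open>Covers the case where the edge is stored as \<open>(j, i)\<close>.\<close>
  moreover have "X $ j $ i = X $ i $ j"
    using sym by (metis transpose_def vec_lambda_beta)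
  moreover have "Y (i, j) = 1" if "(i, j) \<in> E"
    using that by (simp add: Y_def)
  moreover have "Y (j, i) = 1" if "(j, i) \<in> E"
    using that by (simp add: Y_def)
  ultimately show False
    using ij proj by (metis zero_neq_one)
qed

end
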